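(* Let $G$ be a finite group, $V$ a complex irreducible representation of $G$ with character $\chi_V$, and $(\cdot,\cdot)$ any $G$-invariant hermitian scalar product on $V$. Assume $\dim V^H=1$ for a subgroup $H$ of $G$. Then, for any nonzero vector $v\in V^H$, $$(v,gv)=\frac{(v,v)}{|H|}\sum_{h\in H}\chi_V(hg^{-1})$$ for all $g\in G$.
   Context: $V^H$ denotes the subspace of vectors of $V$ fixed by $H$. The hermitian scalar product is linear in the first argument and conjugate-linear in the second. *)

theory Defs
  imports Complex_Main "HOL-Algebra.Group_Action"
begin

text \<open>The trace is computed in the basis \<^term>\<open>vector_space.extend_basis scale {}\<close> of the whole
  space; it does not depend on that choice (lemma \<open>trace_eq_sum_basis\<close>).  It is only meaningful for
  finite-dimensional spaces, since a sum over an infinite basis is \<open>0\<close>.\<close>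

definition linear_trace :: "('a::field \<Rightarrow> 'b::ab_group_add \<Rightarrow> 'b) \<Rightarrow> ('b \<Rightarrow> 'b) \<Rightarrow> 'a"
  where "linear_trace scale f =
    (let B = vector_space.extend_basis scale {} in \<Sum>b\<in>B. module.representation scale B (f b) b)"

lemma (in vector_space) trace_eq_sum_basis:
  assumes f: "Vector_Spaces.linear scale scale f"
    and B: "finite B" "independent B" "span B = UNIV"
  shows "linear_trace scale f = (\<Sum>b\<in>B. representation B (f b) b)"
proof -
  interpret f: Vector_Spaces.linear scale scale f by (rule f)
  define C where "C = extend_basis {}"
  have C: "independent C" "span C = UNIV"
    unfolding C_def using independent_extend_basis[OF independent_empty] span_extend_basis[OF independent_empty] by auto
  have finC: "finite C"
    using independent_span_bound[OF B(1) C(1)] B(3) by auto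
  have expand: "(\<Sum>d\<in>D. scale (representation D v d) d) = v"
    if "finite D" "independent D" "span D = UNIV" for D v
    by (rule sum_representation_eq) (use that in auto)
  have coord: "representation D (f x) y = (\<Sum>e\<in>E. representation E x e * representation D (f e) y)"
    if "finite E" "independent E" "span E = UNIV" "independent D" "span D = UNIV" for D E x y
  proof -
    have "f x = (\<Sum>e\<in>E. scale (representation E x e) (f e))"
      using expand[OF that(1-3), of x] by (metis (no_types, lifting) f.scale f.sum sum.cong)
    then show ?thesis
      using that by (simp add: representation_sum representation_scale)
  qed
  have comp: "(\<Sum>c\<in>C. representation C v c * representation B c b) = representation B v b" for v b
  proof -
    have "representation B (\<Sum>c\<in>C. scale (representation C v c) c) b
        = (\<Sum>c\<in>C. representation C v c * representation B c b)"
      using B by (simp add: representation_sum representation_scale)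
    then show ?thesis using expand[OF finC C] by simp
  qed
  have "linear_trace scale f = (\<Sum>c\<in>C. representation C (f c) c)"
    by (simp add: linear_trace_def C_def Let_def)
  also have "\<dots> = (\<Sum>c\<in>C. \<Sum>b\<in>B. representation B c b * representation C (f b) c)"
    by (intro sum.cong refl coord B C)
  also have "\<dots> = (\<Sum>b\<in>B. \<Sum>c\<in>C. representation C (f b) c * representation B c b)"
    by (subst sum.swap) (simp add: mult.commute)
  also have "\<dots> = (\<Sum>b\<in>B. representation B (f b) b)"
    by (simp add: comp)
  finally show ?thesis .
qed

locale complex_representation =
  group_action G UNIV \<rho> + vector_space scale
  for G (structure) and scale :: "complex \<Rightarrow> 'v::ab_group_add \<Rightarrow> 'v" and \<rho> :: "'g \<Rightarrow> 'v \<Rightarrow> 'v" +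
  assumes linear_action: "g \<in> carrier G \<Longrightarrow> Vector_Spaces.linear scale scale (\<rho> g)"

text \<open>Finite-dimensionality is not assumed: for finite \<open>G\<close> it follows from irreducibility, since the
  span of the orbit of a nonzero vector is an invariant subspace.\<close>

locale irreducible_complex_representation =
  complex_representation G scale \<rho>
  for G (structure) and scale :: "complex \<Rightarrow> 'v::ab_group_add \<Rightarrow> 'v" and \<rho> :: "'g \<Rightarrow> 'v \<Rightarrow> 'v" +
  assumes nonzero: "\<exists>v::'v. v \<noteq> 0"
    and irreducible: "\<lbrakk>subspace W; \<And>g. g \<in> carrier G \<Longrightarrow> \<rho> g ` W \<subseteq> W\<rbrakk> \<Longrightarrow> W = {0} \<or> W = UNIV"

definition rep_character ::
    "(complex \<Rightarrow> 'v \<Rightarrow> 'v::ab_group_add) \<Rightarrow> ('g \<Rightarrow> 'v \<Rightarrow> 'v) \<Rightarrow> 'g \<Rightarrow> complex"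
  where "rep_character scale \<rho> g = linear_trace scale (\<rho> g)"

definition fixed_vectors :: "('g \<Rightarrow> 'v \<Rightarrow> 'v) \<Rightarrow> 'g set \<Rightarrow> 'v set"
  where "fixed_vectors \<rho> H = {v. \<forall>h\<in>H. \<rho> h v = v}"

text \<open>Linear in the first argument, hence conjugate-linear in the second by hermitian symmetry, which
  also makes \<^term>\<open>ip v v\<close> real.\<close>

locale hermitian_scalar_product = vector_space scale
  for scale :: "complex \<Rightarrow> 'v::ab_group_add \<Rightarrow> 'v" +
  fixes ip :: "'v \<Rightarrow> 'v \<Rightarrow> complex"
  assumes linear_left: "Vector_Spaces.linear scale (*) (\<lambda>x. ip x y)"
    and hermitian: "ip y x = cnj (ip x y)"
    and positive_definite: "x \<noteq> 0 \<Longrightarrow> 0 < Re (ip x x)"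

locale invariant_hermitian_scalar_product =
  complex_representation G scale \<rho> + hermitian_scalar_product scale ip
  for G (structure) and scale and \<rho> and ip +
  assumes invariant: "g \<in> carrier G \<Longrightarrow> ip (\<rho> g x) (\<rho> g y) = ip x y"

end

theory Submission
  imports Defs
begin

text \<open>The operator \<open>|H|\<^sup>-\<^sup>1 \<Sum>h\<in>H. \<rho> h\<close> is the orthogonal projection of \<open>V\<close> onto the line
  \<open>V\<^sup>H = \<complex>v\<close>, so it maps \<open>x\<close> to \<open>((x,v) / (v,v)) v\<close>.  Composing it with \<open>\<rho> (g\<^sup>-\<^sup>1)\<close> gives an operator of
  rank one, whose trace \<open>(g\<^sup>-\<^sup>1v,v) / (v,v) = (v,gv) / (v,v)\<close> is the average of the values
  \<open>\<chi>\<^sub>V(hg\<^sup>-\<^sup>1)\<close>.  Irreducibility serves only to make \<open>V\<close> finite-dimensional.\<close>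

context vector_space
begin

lemma subspace_dim_1_multiple:
  assumes W: "subspace W" "dim W = 1" and v: "v \<in> W" "v \<noteq> 0" and w: "w \<in> W"
  obtains c where "w = scale c v"
proof -
  obtain B where "B \<subseteq> W" "independent B" and WB: "W \<subseteq> span B" and "card B = dim W"
    using basis_exists by blast
  then obtain b where B: "B = {b}"
    using W(2) card_1_singletonE by metis
  obtain c d where vc: "v = scale c b" and wd: "w = scale d b"
    using v(1) w WB unfolding B span_singleton by blast
  have "c \<noteq> 0"
    using v(2) vc by auto
  then have "w = scale (d / c) v"
    using vc wd by simp
  then show thesis ..
qed

text \<open>All the traces can be read off in the same basis \<open>B\<close>, where additivity is
  an interchange of two sums.\<close>

lemma linear_trace_sum:
  assumes B: "finite B" "independent B" "span B = UNIV"
    and f: "\<And>i. i \<in> I \<Longrightarrow> Vector_Spaces.linear scale scale (f i)"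
    and F: "Vector_Spaces.linear scale scale (\<lambda>x. \<Sum>i\<in>I. f i x)"
  shows "linear_trace scale (\<lambda>x. \<Sum>i\<in>I. f i x) = (\<Sum>i\<in>I. linear_trace scale (f i))"
proof -
  have "linear_trace scale (\<lambda>x. \<Sum>i\<in>I. f i x) = (\<Sum>b\<in>B. \<Sum>i\<in>I. representation B (f i b) b)"
    using B by (simp add: trace_eq_sum_basis[OF F B] representation_sum)
  also have "\<dots> = (\<Sum>i\<in>I. \<Sum>b\<in>B. representation B (f i b) b)"
    by (rule sum.swap)
  also have "\<dots> = (\<Sum>i\<in>I. linear_trace scale (f i))"
    by (intro sum.cong refl) (simp add: trace_eq_sum_basis[OF f B])
  finally show ?thesis .
qed

text \<open>The diagonal entry at \<open>b\<close> is the \<open>b\<close>-coordinate of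
  \<open>v\<close> times \<open>\<phi> b\<close>; by linearity these products add up to
  \<open>\<phi>\<close> applied to the expansion of \<open>v\<close> in \<open>B\<close>.\<close>

lemma linear_trace_rank_one:
  assumes B: "finite B" "independent B" "span B = UNIV"
    and \<phi>: "Vector_Spaces.linear scale (*) \<phi>"
  shows "linear_trace scale (\<lambda>x. scale (\<phi> x) v) = \<phi> v"
proof -
  interpret \<phi>: Vector_Spaces.linear scale "(*)" \<phi> by (rule \<phi>)
  have lin: "Vector_Spaces.linear scale scale (\<lambda>x. scale (\<phi> x) v)"
    by unfold_locales (simp_all add: \<phi>.add \<phi>.scale scale_left_distrib)
  have "linear_trace scale (\<lambda>x. scale (\<phi> x) v) = (\<Sum>b\<in>B. representation B v b * \<phi> b)"
    using B by (simp add: trace_eq_sum_basis[OF lin B] representation_scale mult.commute)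
  also have "\<dots> = \<phi> (\<Sum>b\<in>B. scale (representation B v b) b)"
    by (simp add: \<phi>.sum \<phi>.scale)
  also have "(\<Sum>b\<in>B. scale (representation B v b) b) = v"
    by (rule sum_representation_eq) (use B in auto)
  finally show ?thesis .
qed

end

context complex_representation
begin

sublocale group G
  using group_hom by (rule group_hom.axioms(1))

lemma action_one [simp]: "\<rho> \<one> x = x"
  using id_eq_one by (metis UNIV_I restrict_apply')

lemma action_mult:
  assumes "g \<in> carrier G" "h \<in> carrier G"
  shows "\<rho> (g \<otimes> h) x = \<rho> g (\<rho> h x)"
  using composition_rule assms by simp

lemma subspace_fixed_vectors:
  assumes "H \<subseteq> carrier G"
  shows "subspace (fixed_vectors \<rho> H)"
proof -
  have "subspace {x. \<rho> h x = x}" if "h \<in> H" for h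
  proof -
    interpret h: Vector_Spaces.linear scale scale "\<rho> h"
      using that assms by (intro linear_action) auto
    show ?thesis
      by (simp add: subspace_def h.zero h.add h.scale)
  qed
  then have "subspace (\<Inter>h\<in>H. {x. \<rho> h x = x})"
    by (auto intro: subspace_Inter)
  moreover have "fixed_vectors \<rho> H = (\<Inter>h\<in>H. {x. \<rho> h x = x})"
    by (auto simp: fixed_vectors_def)
  ultimately show ?thesis
    by simp
qed

lemma sum_action_in_fixed_vectors:
  assumes H: "subgroup H G"
  shows "(\<Sum>h\<in>H. \<rho> h x) \<in> fixed_vectors \<rho> H"
proof -
  interpret H: subgroup H G by (rule H)
  have "\<rho> k (\<Sum>h\<in>H. \<rho> h x) = (\<Sum>h\<in>H. \<rho> h x)" if k: "k \<in> H" for k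
  proof -
    interpret k: Vector_Spaces.linear scale scale "\<rho> k"
      using k by (intro linear_action) simp
    have "\<rho> k (\<Sum>h\<in>H. \<rho> h x) = (\<Sum>h\<in>H. \<rho> (k \<otimes> h) x)"
      using k by (simp add: k.sum action_mult)
    \<comment> \<open>Left multiplication by \<open>k\<close> permutes \<open>H\<close>, with
      inverse left multiplication by \<open>inv k\<close>.\<close>
    also have "\<dots> = (\<Sum>h\<in>H. \<rho> h x)"
      by (rule sum.reindex_bij_witness[of _ "\<lambda>h. inv k \<otimes> h" "\<lambda>h. k \<otimes> h"])
        (use k in \<open>auto simp: m_assoc[symmetric]\<close>)
    finally show ?thesis .
  qed
  then show ?thesis
    by (simp add: fixed_vectors_def)
qed

end

text \<open>The orbit of a nonzero vector is finite and spans a nonzero invariant subspace, hence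
  the whole space; a basis can be chosen inside it. This is what gives access to the trace formulas
  above.\<close>

lemma (in irreducible_complex_representation) finite_basis:
  assumes "finite (carrier G)"
  obtains B where "finite B" "independent B" "span B = UNIV"
proof -
  obtain v :: 'v where v: "v \<noteq> 0"
    using nonzero by blast
  define S where "S = (\<lambda>g. \<rho> g v) ` carrier G"
  have inv: "\<rho> g ` span S \<subseteq> span S" if g: "g \<in> carrier G" for g
  proof -
    interpret g: Vector_Spaces.linear scale scale "\<rho> g"
      using g by (rule linear_action)
    have "\<rho> g ` S \<subseteq> S"
      unfolding S_def using g by (auto simp: action_mult[symmetric])
    then show ?thesis
      unfolding g.span_image[symmetric] by (rule span_mono)
  qed
  \<comment> \<open>The identity puts \<open>v\<close> itself into the orbit, which rules out the
    alternative \<open>span S = {0}\<close>.\<close>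
  have "v \<in> span S"
    unfolding S_def by (metis action_one one_closed imageI span_base)
  then have S: "span S = UNIV"
    using irreducible[OF subspace_span inv] v by blast
  obtain B where B: "B \<subseteq> S" "independent B" "S \<subseteq> span B"
    using maximal_independent_subset by blast
  have "finite B"
    using B(1) assms finite_subset unfolding S_def by blast
  moreover have "span B = UNIV"
    using S B(3) span_minimal[OF B(3) subspace_span] by blast
  ultimately show thesis
    using B(2) that by blast
qed

text \<open>The sum is fixed by \<open>H\<close>, so it lies on the line through \<open>v\<close>;
  pairing it with \<open>v\<close> determines the coefficient. Without division by
  \<open>card H\<close> this is the projection scaled by \<open>card H\<close>.\<close>

lemma (in invariant_hermitian_scalar_product) sum_action_eq_projection:
  assumes H: "subgroup H G" and dim: "dim (fixed_vectors \<rho> H) = 1"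
    and v: "v \<in> fixed_vectors \<rho> H" "v \<noteq> 0"
  shows "(\<Sum>h\<in>H. \<rho> h x) = scale (of_nat (card H) * ip x v / ip v v) v"
proof -
  interpret H: subgroup H G by (rule H)
  interpret ip: Vector_Spaces.linear scale "(*)" "\<lambda>x. ip x v" by (rule linear_left)
  obtain c where c: "(\<Sum>h\<in>H. \<rho> h x) = scale c v"
    using subspace_dim_1_multiple[OF subspace_fixed_vectors dim v sum_action_in_fixed_vectors]
      H H.subset by metis
  \<comment> \<open>Replace \<open>v\<close> by \<open>\<rho> h v\<close> on the left, then use
    invariance.\<close>
  have "ip (\<rho> h x) v = ip x v" if "h \<in> H" for h
    using invariant[of h x v] that v(1) by (simp add: fixed_vectors_def)
  then have "of_nat (card H) * ip x v = ip (\<Sum>h\<in>H. \<rho> h x) v"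
    by (simp add: ip.sum)
  also have "\<dots> = c * ip v v"
    by (simp add: c ip.scale)
  finally have "of_nat (card H) * ip x v = c * ip v v" .
  moreover have "ip v v \<noteq> 0"
    using positive_definite[OF v(2)] by auto
  ultimately show ?thesis
    by (simp add: c)
qed

theorem proposition2p4:
  fixes G :: "('g, 'm) monoid_scheme" (structure)
    and scale :: "complex \<Rightarrow> 'v::ab_group_add \<Rightarrow> 'v"
    and \<rho> :: "'g \<Rightarrow> 'v \<Rightarrow> 'v"
    and ip :: "'v \<Rightarrow> 'v \<Rightarrow> complex"
    and H :: "'g set" and v :: 'v and g :: 'g
  assumes "finite (carrier G)"
    and "irreducible_complex_representation G scale \<rho>"
    and "invariant_hermitian_scalar_product G scale \<rho> ip"
    and "subgroup H G"
    and "vector_space.dim scale (fixed_vectors \<rho> H) = 1"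
    and "v \<in> fixed_vectors \<rho> H" and "v \<noteq> 0"
    and "g \<in> carrier G"
  shows "ip v (\<rho> g v) =
    ip v v / of_nat (card H) * (\<Sum>h\<in>H. rep_character scale \<rho> (h \<otimes> inv g))"
proof -
  interpret irreducible_complex_representation G scale \<rho> by fact
  interpret invariant_hermitian_scalar_product G scale \<rho> ip by fact
  interpret H: subgroup H G by fact
  obtain B where B: "finite B" "independent B" "span B = UNIV"
    using finite_basis[OF assms(1)] .
  note g = \<open>g \<in> carrier G\<close>
  have "card H \<noteq> 0"
    using assms(1) H.subset H.one_closed by (metis card_eq_0_iff empty_iff finite_subset)
  have "ip v v \<noteq> 0"
    using positive_definite[OF assms(7)] by auto
  define c where "c = of_nat (card H) / ip v v"
  \<comment> \<open>\<open>\<phi> x\<close> is the coefficient of \<open>v\<close> when the summed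
    action of \<open>H\<close> is applied to \<open>\<rho> (inv g) x\<close>.\<close>
  define \<phi> where "\<phi> = (\<lambda>x. c * ip (\<rho> (inv g) x) v)"
  interpret ip: Vector_Spaces.linear scale "(*)" "\<lambda>x. ip x v" by (rule linear_left)
  interpret gi: Vector_Spaces.linear scale scale "\<rho> (inv g)"
    by (rule linear_action[OF inv_closed[OF g]])
  have \<phi>: "Vector_Spaces.linear scale (*) \<phi>"
    unfolding \<phi>_def
    by unfold_locales (simp_all add: gi.add gi.scale ip.add ip.scale distrib_left)
  interpret \<phi>: Vector_Spaces.linear scale "(*)" \<phi> by (rule \<phi>)
  have eq: "(\<lambda>x. \<Sum>h\<in>H. \<rho> (h \<otimes> inv g) x) = (\<lambda>x. scale (\<phi> x) v)"
    using g sum_action_eq_projection[OF assms(4-7)]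
    by (simp add: action_mult \<phi>_def c_def)
  \<comment> \<open>Additivity turns the character sum into the trace of a single operator, which by
    \<open>eq\<close> has rank at most one.\<close>
  have "(\<Sum>h\<in>H. rep_character scale \<rho> (h \<otimes> inv g))
      = linear_trace scale (\<lambda>x. \<Sum>h\<in>H. \<rho> (h \<otimes> inv g) x)"
    unfolding rep_character_def
  proof (rule linear_trace_sum[OF B, symmetric])
    show "Vector_Spaces.linear scale scale (\<lambda>x. \<Sum>h\<in>H. \<rho> (h \<otimes> inv g) x)"
      unfolding eq by unfold_locales (simp_all add: \<phi>.add \<phi>.scale scale_left_distrib)
  qed (use g in \<open>simp add: linear_action\<close>)
  also have "\<dots> = c * ip (\<rho> (inv g) v) v"
    using linear_trace_rank_one[OF B \<phi>, of v] unfolding eq by (simp add: \<phi>_def)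
  \<comment> \<open>Acting by \<open>g\<close> on both arguments cancels \<open>inv g\<close> in the
    first and moves \<open>g\<close> to the second.\<close>
  also have "ip (\<rho> (inv g) v) v = ip v (\<rho> g v)"
    using invariant[OF g, of "\<rho> (inv g) v" v] g by (simp flip: action_mult)
  finally show ?thesis
    using \<open>card H \<noteq> 0\<close> \<open>ip v v \<noteq> 0\<close> by (simp add: c_def)
qed

end
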